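(* Let $s,t$ be integers with $t\ge s\ge 2$. The pair $(s,t)$ is admissible if and only if $t \geq \frac32(s-3) +\frac{4}{s-1}$.
   Context: For integers $t\ge s\ge 2$ and a (finite simple) graph $L$ on $s-1$ vertices with degrees $d_L(v)$, put $$\psi(L)=3\sum_{v\in V(L)}d_L(v)^2-\frac{2}{s-1} \left(\sum_{v\in V(L)} d_L(v)\right)^2 - (t-1)\sum_{v\in V(L)} d_L(v).$$ The pair $(s,t)$ is called admissible if the maximum of $\psi$ over all graphs on $s-1$ vertices is attained only by $(s-1)K_1$ (the edgeless graph on $s-1$ vertices), i.e., $\psi(L)\leq 0$ for every graph $L$ on $s-1$ vertices, with $\psi(L)=0$ only if $L=(s-1)K_1$.
   Formalization: The pair s = t = 2 is excluded: there the only graph is a single vertex with ψ = 0, so (2,2) is admissible although the bound 5/2 exceeds t = 2; all other pairs t ≥ s ≥ 2 are covered. *)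

theory Defs
  imports Complex_Main "Graph_Theory.Pair_Digraph"
begin

text \<open>
  A finite simple graph is a \<open>pair_graph\<close>: a finite, loop-free, symmetric digraph without
  parallel arcs. Each undirected edge \<open>uv\<close> is represented by the two arcs \<open>(u, v)\<close> and
  \<open>(v, u)\<close>, so the out-degree of a vertex is its degree in the undirected graph.
\<close>

definition deg :: "'a pair_pre_digraph \<Rightarrow> 'a \<Rightarrow> nat" where
  "deg L v = out_degree (with_proj L) v"

definition psi :: "nat \<Rightarrow> nat \<Rightarrow> 'a pair_pre_digraph \<Rightarrow> real" where
  "psi s t L =
     3 * (\<Sum>v\<in>pverts L. (real (deg L v))\<^sup>2)
     - 2 / (real s - 1) * (\<Sum>v\<in>pverts L. real (deg L v))\<^sup>2
     - (real t - 1) * (\<Sum>v\<in>pverts L. real (deg L v))"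

text \<open>
  The vertices are natural numbers; every finite graph is isomorphic to one of this kind.
\<close>

definition admissible :: "nat \<Rightarrow> nat \<Rightarrow> bool" where
  "admissible s t \<longleftrightarrow>
     (\<forall>L :: nat pair_pre_digraph. pair_graph L \<and> card (pverts L) = s - 1 \<longrightarrow>
        psi s t L \<le> 0 \<and> (psi s t L = 0 \<longrightarrow> parcs L = {}))"

text \<open>
  For \<open>s = 2\<close> the only graph on \<open>s - 1\<close> vertices is the edgeless one, so \<open>(2, t)\<close> is
  admissible for every \<open>t\<close>, whereas the lower bound on \<open>t\<close> evaluates to \<open>5/2\<close>.
  Hence \<open>s = t = 2\<close> is an exception to the characterisation by that bound.
\<close>

lemma admissible_2: "admissible 2 t"
proof -
  have "parcs L = {}" if "pair_graph L" "card (pverts L) = 2 - 1" for L :: "nat pair_pre_digraph"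
  proof -
    interpret pair_graph L by fact
    from that(2) obtain x where x: "pverts L = {x}"
      by (auto simp: card_1_singleton_iff)
    show ?thesis
    proof (rule ccontr)
      assume "parcs L \<noteq> {}"
      then obtain u v where "(u, v) \<in> parcs L" by auto
      with wellformed'[of u v] no_loops'[of u v] x show False by auto
    qed
  qed
  then show ?thesis
    by (auto simp: admissible_def psi_def deg_def out_degree_def out_arcs_def)
qed

lemma exception_2_2:
  "admissible 2 2 \<and> \<not> real 2 \<ge> 3 / 2 * (real 2 - 3) + 4 / (real 2 - 1)"
  using admissible_2[of 2] by simp

end

theory Submission
  imports Defs
begin

text \<open>
  Write \<open>n = s - 1\<close> and let \<open>e\<close> be the number of edges. For \<open>n \<ge> 2\<close>, the star
  \<open>K\<^bsub>1,n-1\<^esub>\<close> has \<open>\<psi> \<le> 0\<close> exactly when the bound on \<open>t\<close> holds. Conversely, de Caen's inequality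
  \<open>\<Sum>d\<^sup>2 \<le> e (2e/(n-1) + n - 2)\<close> makes \<open>\<psi>\<close> negative for \<open>e \<ge> n - 1\<close>, and the
  inequality \<open>\<Sum>d\<^sup>2 \<le> e (e + 1)\<close> does so for \<open>e \<le> n - 1\<close>; both are sharp at the star.
  When the bound on \<open>t\<close> is an equality, the star has \<open>\<psi> = 0\<close>, but integrality of \<open>t\<close>
  then forces \<open>n\<close> to divide \<open>8\<close>, and no such \<open>n\<close> is compatible with \<open>t \<ge> s\<close>.
\<close>

section \<open>Neighbourhoods and double counting over arcs\<close>

definition nbrs :: "'a pair_pre_digraph \<Rightarrow> 'a \<Rightarrow> 'a set" where
  "nbrs L v = {u. (v, u) \<in> parcs L}"

lemma deg_eq_card_nbrs: "deg L v = card (nbrs L v)"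
proof -
  have "out_arcs (with_proj L) v = Pair v ` nbrs L v"
    by (auto simp: out_arcs_def nbrs_def)
  then show ?thesis
    by (simp add: deg_def out_degree_def card_image inj_on_def)
qed

context pair_graph
begin

lemma nbrs_sym: "u \<in> nbrs G v \<longleftrightarrow> v \<in> nbrs G u"
  using arcs_symmetric by (auto simp: nbrs_def)

lemma nbrs_subset: "nbrs G v \<subseteq> pverts G"
  using wellformed' by (auto simp: nbrs_def)

lemma nbrs_irrefl: "v \<notin> nbrs G v"
  using no_loops' by (auto simp: nbrs_def)

lemma finite_nbrs: "finite (nbrs G v)"
  using finite_subset[OF nbrs_subset pair_finite_verts] .

lemma deg_less:
  assumes "v \<in> pverts G"
  shows "deg G v < card (pverts G)"
  unfolding deg_eq_card_nbrs
proof (rule psubset_card_mono)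
  show "nbrs G v \<subset> pverts G"
    using assms nbrs_subset[of v] nbrs_irrefl[of v] by blast
qed (rule pair_finite_verts)

lemma sum_sum_nbrs_swap:
  fixes f :: "'a \<Rightarrow> 'a \<Rightarrow> 'b::comm_monoid_add"
  shows "(\<Sum>v\<in>pverts G. \<Sum>u\<in>nbrs G v. f v u) = (\<Sum>v\<in>pverts G. \<Sum>u\<in>nbrs G v. f u v)"
proof -
  have r: "(\<Sum>u\<in>nbrs G v. g u) = (\<Sum>u\<in>pverts G. if u \<in> nbrs G v then g u else 0)"
    for g :: "'a \<Rightarrow> 'b" and v
    using nbrs_subset[of v] by (simp add: sum.If_cases pair_finite_verts Int_absorb1)
  show ?thesis
    unfolding r by (subst sum.swap) (simp add: nbrs_sym)
qed

lemma sum_sum_nbrs: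
  fixes f :: "'a \<Rightarrow> nat"
  shows "(\<Sum>v\<in>pverts G. \<Sum>u\<in>nbrs G v. f u) = (\<Sum>v\<in>pverts G. deg G v * f v)"
  by (subst sum_sum_nbrs_swap) (simp add: deg_eq_card_nbrs)

text \<open>Both sides count the walks \<open>v - u - w\<close>: on the left by the middle vertex,
  on the right by the end vertex.\<close>

lemma sum_deg_nbrs_eq:
  "(\<Sum>u\<in>nbrs G v. deg G u) = (\<Sum>w\<in>pverts G. card (nbrs G v \<inter> nbrs G w))"
proof -
  have "(\<Sum>u\<in>nbrs G v. deg G u) = (\<Sum>u\<in>nbrs G v. \<Sum>w\<in>pverts G. if w \<in> nbrs G u then 1 else 0)"
    using nbrs_subset by (simp add: deg_eq_card_nbrs sum.If_cases pair_finite_verts Int_absorb1)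
  also have "\<dots> = (\<Sum>w\<in>pverts G. \<Sum>u\<in>nbrs G v. if u \<in> nbrs G w then 1 else 0)"
    by (subst sum.swap) (simp add: nbrs_sym)
  also have "\<dots> = (\<Sum>w\<in>pverts G. card (nbrs G v \<inter> nbrs G w))"
    by (simp add: sum.If_cases finite_nbrs Int_def)
  finally show ?thesis .
qed

lemma sum_verts_split:
  fixes f :: "'a \<Rightarrow> nat"
  assumes "v \<in> pverts G"
  shows "(\<Sum>w\<in>pverts G. f w)
    = f v + (\<Sum>u\<in>nbrs G v. f u) + (\<Sum>w\<in>pverts G - insert v (nbrs G v). f w)"
proof -
  have "insert v (nbrs G v) \<subseteq> pverts G" using assms nbrs_subset by auto
  then have "(\<Sum>w\<in>pverts G. f w)
      = (\<Sum>w\<in>pverts G - insert v (nbrs G v). f w) + (\<Sum>w\<in>insert v (nbrs G v). f w)"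
    by (intro sum.subset_diff pair_finite_verts)
  then show ?thesis by (simp add: finite_nbrs nbrs_irrefl)
qed

section \<open>Local degree bounds and the sum of squared degrees\<close>

lemma sum_deg_nbrs_le:
  assumes "v \<in> pverts G"
  shows "deg G v + (\<Sum>u\<in>nbrs G v. deg G u) \<le> (\<Sum>w\<in>pverts G. deg G w)"
  using sum_verts_split[OF assms, of "deg G"] by simp

text \<open>Count the walks of length two from \<open>v\<close> by their end \<open>w\<close>:
  \<open>w = v\<close> gives \<open>deg G v\<close>, each neighbour at most
  \<open>deg G v - 1\<close>, any other \<open>w\<close> at most \<open>deg G w\<close>. A second
  copy of the sum completes these last degrees to the total.\<close>

lemma two_sum_deg_nbrs_le:
  assumes "v \<in> pverts G"
  shows "2 * (\<Sum>u\<in>nbrs G v. deg G u) \<le> deg G v * (deg G v - 1) + (\<Sum>w\<in>pverts G. deg G w)"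
proof -
  let ?c = "\<lambda>w. card (nbrs G v \<inter> nbrs G w)" and ?W = "pverts G - insert v (nbrs G v)"
  have "?c u \<le> deg G v - 1" if "u \<in> nbrs G v" for u
  proof -
    have "nbrs G v \<inter> nbrs G u \<subseteq> nbrs G v - {u}" using nbrs_irrefl[of u] by auto
    from card_mono[OF _ this] that show ?thesis by (simp add: finite_nbrs deg_eq_card_nbrs)
  qed
  then have "(\<Sum>u\<in>nbrs G v. ?c u) \<le> deg G v * (deg G v - 1)"
    using sum_bounded_above[of "nbrs G v" ?c "deg G v - 1"] by (simp add: deg_eq_card_nbrs)
  moreover have "(\<Sum>w\<in>?W. ?c w) \<le> (\<Sum>w\<in>?W. deg G w)"
    by (intro sum_mono) (simp add: deg_eq_card_nbrs card_mono finite_nbrs)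
  moreover have "?c v = deg G v" by (simp add: deg_eq_card_nbrs)
  ultimately show ?thesis
    using sum_verts_split[OF assms, of "deg G"] sum_verts_split[OF assms, of ?c]
      sum_deg_nbrs_eq[of v] by linarith
qed

text \<open>The edges at \<open>u\<close> or \<open>v\<close> number
  \<open>deg G u + deg G v - 1\<close>, as only \<open>uv\<close> is counted twice; the degree sum
  is twice the number of all edges.\<close>

lemma two_deg_add_deg_le:
  assumes "u \<in> nbrs G v"
  shows "2 * (deg G u + deg G v) \<le> (\<Sum>w\<in>pverts G. deg G w) + 2"
proof -
  let ?R = "pverts G - {u, v}"
  have uv: "u \<in> pverts G" "v \<in> pverts G" "u \<noteq> v" "v \<in> nbrs G u"
    using assms nbrs_subset nbrs_sym nbrs_irrefl by blast+
  have ind: "card (nbrs G x) = (\<Sum>w\<in>pverts G. if w \<in> nbrs G x then 1 else 0)" for x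
    using nbrs_subset[of x] by (simp add: sum.If_cases pair_finite_verts Int_absorb1)
  have split: "(\<Sum>w\<in>pverts G. f w) = f u + f v + (\<Sum>w\<in>?R. f w)" for f :: "'a \<Rightarrow> nat"
    using uv sum.subset_diff[of "{u, v}" "pverts G" f] by (simp add: pair_finite_verts)
  define a b :: "'a \<Rightarrow> nat" where "a = (\<lambda>w. if w \<in> nbrs G u then 1 else 0)"
    and "b = (\<lambda>w. if w \<in> nbrs G v then 1 else 0)"
  have "a w + b w \<le> deg G w" for w
  proof -
    have "card (nbrs G w \<inter> {u, v}) \<le> deg G w"
      by (simp add: deg_eq_card_nbrs card_mono finite_nbrs)
    then show ?thesis
      using uv nbrs_sym[of w u] nbrs_sym[of w v] by (auto simp: a_def b_def split: if_splits)
  qed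
  then have "(\<Sum>w\<in>?R. a w + b w) \<le> (\<Sum>w\<in>?R. deg G w)"
    by (rule sum_mono)
  moreover have "deg G u = 1 + (\<Sum>w\<in>?R. a w)"
    using uv nbrs_irrefl unfolding deg_eq_card_nbrs ind split by (simp add: a_def)
  moreover have "deg G v = 1 + (\<Sum>w\<in>?R. b w)"
    using assms nbrs_irrefl unfolding deg_eq_card_nbrs ind split by (simp add: b_def)
  ultimately show ?thesis
    using split[of "deg G"] by (simp add: sum.distrib)
qed

text \<open>Summing \<open>deg G u + deg G v\<close> over all arcs gives twice the sum of squares,
  and \<open>two_deg_add_deg_le\<close> bounds each term.\<close>

lemma sum_sq_deg_le_edges:
  "4 * (\<Sum>v\<in>pverts G. (deg G v)\<^sup>2) \<le> (\<Sum>v\<in>pverts G. deg G v) * ((\<Sum>v\<in>pverts G. deg G v) + 2)"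
proof -
  let ?D = "\<Sum>v\<in>pverts G. deg G v"
  have "(\<Sum>u\<in>nbrs G v. 2 * (deg G u + deg G v)) = 2 * (\<Sum>u\<in>nbrs G v. deg G u) + 2 * (deg G v)\<^sup>2"
    for v
    by (simp add: sum.distrib sum_distrib_left distrib_left power2_eq_square deg_eq_card_nbrs)
  then have "4 * (\<Sum>v\<in>pverts G. (deg G v)\<^sup>2)
      = (\<Sum>v\<in>pverts G. \<Sum>u\<in>nbrs G v. 2 * (deg G u + deg G v))"
    using sum_sum_nbrs[of "deg G"]
    by (simp only: sum.distrib sum_distrib_left[symmetric] power2_eq_square)
  also have "\<dots> \<le> (\<Sum>v\<in>pverts G. \<Sum>u\<in>nbrs G v. ?D + 2)"
    by (intro sum_mono two_deg_add_deg_le)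
  also have "\<dots> = ?D * (?D + 2)"
    by (simp only: sum_constant deg_eq_card_nbrs of_nat_id sum_distrib_right)
  finally show ?thesis .
qed

text \<open>
  Divided by \<open>d (n - 1)\<close>, this says that the degree \<open>d\<close> of \<open>v\<close> plus the average degree of
  its neighbours is at most \<open>2e/(n-1) + n - 2\<close>. Below \<open>S = d\<^sup>2\<close>, the
  bound \<open>S + d \<le> 2e\<close> suffices; above it, \<open>2S - d(d-1) \<le> 2e\<close> and \<open>S \<le> d(n-1)\<close>.
\<close>
lemma deg_nbrs_bound:
  fixes v
  defines "d \<equiv> real (deg G v)" and "S \<equiv> real (\<Sum>u\<in>nbrs G v. deg G u)"
    and "N \<equiv> real (card (pverts G)) - 1" and "D \<equiv> real (\<Sum>w\<in>pverts G. deg G w)"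
  assumes v: "v \<in> pverts G"
  shows "N * (d\<^sup>2 + S) \<le> d * (D + N * (N - 1))"
proof (cases "deg G v = 0")
  case True
  then have "nbrs G v = {}" by (simp add: deg_eq_card_nbrs finite_nbrs)
  with True show ?thesis by (simp add: d_def S_def)
next
  case False
  then have d1: "d \<ge> 1" by (simp add: d_def)
  have dN: "d \<le> N" using deg_less[OF v] by (simp add: d_def N_def)
  have S1: "S + d \<le> D"
    using sum_deg_nbrs_le[OF v] unfolding S_def d_def D_def by linarith
  have S2: "2 * S - d * (d - 1) \<le> D"
  proof -
    have "real (2 * (\<Sum>u\<in>nbrs G v. deg G u))
        \<le> real (deg G v * (deg G v - 1) + (\<Sum>w\<in>pverts G. deg G w))"
      using two_sum_deg_nbrs_le[OF v] by (simp only: of_nat_le_iff)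
    then show ?thesis
      using False by (simp add: S_def d_def D_def of_nat_diff)
  qed
  have S3: "S \<le> d * N"
  proof -
    have "real (deg G u) \<le> N" if "u \<in> nbrs G v" for u
      using deg_less[of u] nbrs_subset that by (fastforce simp: N_def)
    then show ?thesis
      using sum_bounded_above[of "nbrs G v" "\<lambda>u. real (deg G u)" N]
      by (simp add: S_def d_def deg_eq_card_nbrs)
  qed
  \<comment> \<open>\<open>N - d\<close> is a nonnegative integer, so it is 0 or at least 1.\<close>
  have int: "(N - d) * (N - d - 1) \<ge> 0"
  proof (cases "d = N")
    case False
    then have "deg G v + 2 \<le> card (pverts G)"
      using deg_less[OF v] unfolding d_def N_def by linarith
    then have "N - d - 1 \<ge> 0" unfolding d_def N_def by linarith
    with dN show ?thesis by simp
  qed simp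
  show ?thesis
  proof (cases "S \<le> d\<^sup>2")
    case True
    \<comment> \<open>The sum expands to the right side of the goal minus the left.\<close>
    have "0 \<le> (N - d) * (d\<^sup>2 - S) + d * ((N - d) * (N - d - 1)) + d * (D - S - d)"
      using True int d1 dN S1 by simp
    then show ?thesis by (simp add: algebra_simps power2_eq_square)
  next
    case False
    \<comment> \<open>This is what remains of the goal once \<open>D\<close> is replaced by its
      lower bound \<open>2 * S - d * (d - 1)\<close>.\<close>
    have "(S - d\<^sup>2) * (N - 2 * d) \<le> d * ((N - d) * (N - d - 1))"
    proof (cases "N \<le> 2 * d")
      case True
      then have "(S - d\<^sup>2) * (N - 2 * d) \<le> 0"
        using False by (simp add: mult_nonneg_nonpos)
      moreover have "0 \<le> d * ((N - d) * (N - d - 1))"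
        using int d1 by simp
      ultimately show ?thesis by linarith
    next
      case c: False
      have "(S - d\<^sup>2) * (N - 2 * d) \<le> (d * (N - d)) * (N - 2 * d)"
        using c S3 by (intro mult_right_mono) (auto simp: algebra_simps power2_eq_square)
      also have "\<dots> \<le> (d * (N - d)) * (N - d - 1)"
        using d1 dN by (intro mult_left_mono) auto
      finally show ?thesis by (simp add: mult.assoc)
    qed
    moreover have "0 \<le> d * (D - (2 * S - d * (d - 1)))"
      using S2 d1 by simp
    ultimately show ?thesis by (simp add: algebra_simps power2_eq_square)
  qed
qed

text \<open>Sum \<open>deg_nbrs_bound\<close> over all vertices. The neighbour degrees also total
  the sum of squares, hence the factor 2.\<close>

lemma de_Caen:
  defines "N \<equiv> real (card (pverts G)) - 1" and "D \<equiv> \<Sum>v\<in>pverts G. real (deg G v)"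
  shows "2 * N * (\<Sum>v\<in>pverts G. (real (deg G v))\<^sup>2) \<le> D * (D + N * (N - 1))"
proof -
  have D: "real (\<Sum>v\<in>pverts G. deg G v) = D" by (simp add: D_def)
  have S: "(\<Sum>v\<in>pverts G. real (\<Sum>u\<in>nbrs G v. deg G u)) = (\<Sum>v\<in>pverts G. (real (deg G v))\<^sup>2)"
    using arg_cong[OF sum_sum_nbrs[of "deg G"], of real] by (simp add: power2_eq_square)
  have "2 * N * (\<Sum>v\<in>pverts G. (real (deg G v))\<^sup>2)
      = (\<Sum>v\<in>pverts G. N * ((real (deg G v))\<^sup>2 + real (\<Sum>u\<in>nbrs G v. deg G u)))"
    unfolding sum_distrib_left[symmetric] sum.distrib S by simp
  also have "\<dots> \<le> (\<Sum>v\<in>pverts G. real (deg G v) * (D + N * (N - 1)))"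
    using deg_nbrs_bound unfolding N_def D by (intro sum_mono) blast
  also have "\<dots> = D * (D + N * (N - 1))"
    by (simp add: D_def sum_distrib_right)
  finally show ?thesis .
qed

section \<open>Negativity of \<open>psi\<close> on graphs with an edge\<close>

lemma psi_neg:
  assumes s: "card (pverts G) = s - 1" "2 \<le> s" "s \<le> t"
    and t: "real t > 3 / 2 * (real s - 3) + 4 / (real s - 1)"
    and ne: "parcs G \<noteq> {}"
  shows "psi s t G < 0"
proof -
  define n D Q where "n = real s - 1" and "D = (\<Sum>v\<in>pverts G. real (deg G v))"
    and "Q = (\<Sum>v\<in>pverts G. (real (deg G v))\<^sup>2)"
  have n: "real (card (pverts G)) = n" using s by (simp add: n_def of_nat_diff)
  obtain u v where uv: "u \<in> nbrs G v" using ne by (auto simp: nbrs_def)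
  have vV: "v \<in> pverts G" using uv nbrs_subset nbrs_sym by blast
  have dv: "0 < deg G v"
    using uv by (auto simp: deg_eq_card_nbrs card_gt_0_iff finite_nbrs)
  have "real (deg G v) \<le> D"
    unfolding D_def using vV by (intro member_le_sum) (auto simp: pair_finite_verts)
  with dv have D0: "D > 0" by simp
  have "card (pverts G) \<ge> 2" using dv deg_less[OF vV] by linarith
  then have n2: "n \<ge> 2" using n by linarith
  have Dn: "D \<le> n * (n - 1)"
  proof -
    have "D \<le> (\<Sum>v\<in>pverts G. n - 1)"
      unfolding D_def using deg_less n by (intro sum_mono) fastforce
    then show ?thesis using n by simp
  qed
  have Q1: "2 * (n - 1) * Q \<le> D * (D + (n - 1) * (n - 2))"
    using de_Caen by (simp add: n D_def Q_def)
  have "real (4 * (\<Sum>v\<in>pverts G. (deg G v)\<^sup>2))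
      \<le> real ((\<Sum>v\<in>pverts G. deg G v) * ((\<Sum>v\<in>pverts G. deg G v) + 2))"
    using sum_sq_deg_le_edges by (simp only: of_nat_le_iff)
  then have Q2: "4 * Q \<le> D * (D + 2)" by (simp add: Q_def D_def distrib_left)
  have tn: "real t \<ge> n + 1" using s by (simp add: n_def)
  have t': "2 * real t * n > 3 * n\<^sup>2 - 6 * n + 8"
    using t n2 unfolding n_def by (simp add: field_simps power2_eq_square)
  have psi: "psi s t G = 3 * Q - 2 / n * D\<^sup>2 - (real t - 1) * D"
    by (simp add: psi_def n_def D_def Q_def)
  have "n * (3 * Q) < 2 * D\<^sup>2 + n * (real t - 1) * D"
  \<comment> \<open>The star has \<open>D = 2 * (n - 1)\<close>, where the two bounds on
    \<open>Q\<close> agree.\<close>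
  proof (cases "D \<le> 2 * (n - 1) \<and> n \<ge> 3")
    case True
    \<comment> \<open>\<open>3 * n * (D + 2) - 8 * D\<close> has slope \<open>3 * n - 8 > 0\<close>
      in \<open>D\<close>, so the worst case is the star's \<open>D\<close>, which \<open>t'\<close>
      settles.\<close>
    have "0 \<le> (3 * n - 8) * (2 * (n - 1) - D)" using True by simp
    then have "3 * n * (D + 2) < 8 * D + 4 * n * (real t - 1)"
      using t' by (simp add: algebra_simps power2_eq_square)
    then have "D * (3 * n * (D + 2)) < D * (8 * D + 4 * n * (real t - 1))"
      using D0 by simp
    moreover have "3 * n * (4 * Q) \<le> 3 * n * (D * (D + 2))"
      using Q2 n2 by (intro mult_left_mono) auto
    ultimately show ?thesis by (simp add: algebra_simps power2_eq_square)
  next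
    case False
    have "3 * n * (D + (n - 1) * (n - 2)) < (n - 1) * (4 * D + 2 * n * (real t - 1))"
    proof (cases "n \<ge> 4")
      case True
      \<comment> \<open>Right minus left has slope \<open>n - 4\<close> in \<open>D\<close>, so the
        star's \<open>D\<close> is again the worst case.\<close>
      have "0 \<le> (n - 4) * (D - 2 * (n - 1))" using True False by simp
      moreover have "(n - 1) * (3 * n\<^sup>2 - 6 * n + 8) < (n - 1) * (2 * real t * n)"
        using t' n2 by simp
      ultimately show ?thesis by (simp add: algebra_simps power2_eq_square)
    next
      case c: False
      \<comment> \<open>For \<open>n < 4\<close> de Caen's bound for \<open>\<psi> / e\<close> increases with \<open>e\<close>: compare with the complete graph.\<close>
      have "(4 - n) * D \<le> (4 - n) * (n * (n - 1))"
        using c Dn by (intro mult_left_mono) auto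
      moreover have "n * (n - 1) * (n + 1) \<le> n * (n - 1) * real t"
        using n2 tn by (intro mult_left_mono) auto
      moreover have "0 < n * (n - 1)" using n2 by simp
      ultimately show ?thesis by (simp add: algebra_simps power2_eq_square)
    qed
    then have "D * (3 * n * (D + (n - 1) * (n - 2)))
        < D * ((n - 1) * (4 * D + 2 * n * (real t - 1)))"
      using D0 by simp
    moreover have "3 * n * (2 * (n - 1) * Q) \<le> 3 * n * (D * (D + (n - 1) * (n - 2)))"
      using Q1 n2 by (intro mult_left_mono) auto
    ultimately have "2 * (n - 1) * (n * (3 * Q)) < 2 * (n - 1) * (2 * D\<^sup>2 + n * (real t - 1) * D)"
      by (simp add: algebra_simps power2_eq_square)
    then show ?thesis using n2 by (simp add: mult_less_cancel_left_pos)
  qed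
  then have "n * psi s t G < 0"
    using n2 by (simp add: psi algebra_simps)
  then show ?thesis using n2 by (simp add: mult_less_0_iff)
qed

end

section \<open>The star and the case of equality\<close>

definition star :: "nat \<Rightarrow> nat pair_pre_digraph" where
  "star n = \<lparr>pverts = {..<n}, parcs = {0} \<times> {1..<n} \<union> {1..<n} \<times> {0}\<rparr>"

lemma pair_graph_star: "n > 0 \<Longrightarrow> pair_graph (star n)"
  by unfold_locales (auto simp: star_def symmetric_def sym_def)

lemma psi_star:
  assumes "2 \<le> s"
  shows "psi s t (star (s - 1))
    = 2 * (real s - 2) * (3 / 2 * (real s - 3) + 4 / (real s - 1) - real t)"
proof -
  \<comment> \<open>The centre 0 then has degree \<open>m\<close>, and there are \<open>m\<close>
    leaves.\<close>
  obtain m where m: "s = Suc (Suc m)" using assms by (metis Suc_le_D numeral_2_eq_2 Suc_le_mono)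
  have nbrs: "nbrs (star (Suc m)) 0 = {1..<Suc m}"
    "\<And>i. nbrs (star (Suc m)) (Suc i) = (if i < m then {0} else {})"
    by (auto simp: nbrs_def star_def)
  have sum: "(\<Sum>v\<in>pverts (star (Suc m)). f (deg (star (Suc m)) v)) = f m + real m * f 1"
    for f :: "nat \<Rightarrow> real"
    by (simp add: star_def[of "Suc m", THEN arg_cong[of _ _ pverts]] sum.lessThan_Suc_shift
        deg_eq_card_nbrs nbrs del: sum.lessThan_Suc)
  show ?thesis
    unfolding psi_def m using sum[of "\<lambda>d. (real d)\<^sup>2"] sum[of real]
    by (simp add: divide_simps) (simp add: algebra_simps power2_eq_square)
qed

lemma bound_not_attained:
  fixes s t :: nat
  assumes "2 \<le> s" "s \<le> t"
  shows "real t \<noteq> 3 / 2 * (real s - 3) + 4 / (real s - 1)"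
proof
  assume eq: "real t = 3 / 2 * (real s - 3) + 4 / (real s - 1)"
  obtain n where n: "s = Suc n" "n \<ge> 1" using assms by (cases s) auto
  have "real (2 * t * n + 6 * n) = real (3 * n * n + 8)"
    using eq n by (simp add: field_simps)
  then have e: "2 * t * n + 6 * n = 3 * n * n + 8" by (simp only: of_nat_eq_iff)
  then have "n dvd 3 * n * n + 8" by (metis dvd_add dvd_triv_right)
  then have "n dvd 8" by (metis dvd_add_right_iff dvd_triv_right)
  then have "n \<in> {1, 2, 4, 8}"
  proof -
    have "n \<le> 8" using \<open>n dvd 8\<close> by (simp add: dvd_imp_le)
    then have "n = 1 \<or> n = 2 \<or> n = 3 \<or> n = 4 \<or> n = 5 \<or> n = 6 \<or> n = 7 \<or> n = 8"
      using n by linarith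
    then show ?thesis using \<open>n dvd 8\<close> by (auto simp: dvd_eq_mod_eq_0)
  qed
  \<comment> \<open>\<open>n = 1\<close> and \<open>n = 8\<close> give no integer \<open>t\<close>;
    \<open>n = 2\<close> and \<open>n = 4\<close> give \<open>t = n < s\<close>.\<close>
  with e n assms show False by auto presburger+
qed

theorem theorem3:
  fixes s t :: nat
  assumes "2 \<le> s" and "s \<le> t"
    and "(s, t) \<noteq> (2, 2)"
  shows "admissible s t \<longleftrightarrow> real t \<ge> 3 / 2 * (real s - 3) + 4 / (real s - 1)"
proof
  assume adm: "admissible s t"
  show "real t \<ge> 3 / 2 * (real s - 3) + 4 / (real s - 1)"
  proof (cases "s = 2")
    case True
    \<comment> \<open>Here the bound is 5/2, and excluding \<open>(2, 2)\<close> leaves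
      \<open>t \<ge> 3\<close>.\<close>
    then show ?thesis using assms by auto
  next
    case False
    have "card (pverts (star (s - 1))) = s - 1" by (simp add: star_def)
    with adm have "psi s t (star (s - 1)) \<le> 0"
      using pair_graph_star[of "s - 1"] assms unfolding admissible_def by auto
    \<comment> \<open>For \<open>s > 2\<close> the factor \<open>2 * (real s - 2)\<close> in
      \<open>psi_star\<close> is positive.\<close>
    then show ?thesis
      using False assms unfolding psi_star[OF assms(1)] by (auto simp: mult_le_0_iff)
  qed
next
  assume "real t \<ge> 3 / 2 * (real s - 3) + 4 / (real s - 1)"
  then have t: "real t > 3 / 2 * (real s - 3) + 4 / (real s - 1)"
    using bound_not_attained[OF assms(1,2)] by linarith
  have "psi s t L \<le> 0 \<and> (psi s t L = 0 \<longrightarrow> parcs L = {})"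
    if "pair_graph L" "card (pverts L) = s - 1" for L :: "nat pair_pre_digraph"
  proof (cases "parcs L = {}")
    case True
    then show ?thesis by (simp add: psi_def deg_eq_card_nbrs nbrs_def)
  next
    case False
    then show ?thesis
      using pair_graph.psi_neg[OF that assms(1,2) t] by simp
  qed
  then show "admissible s t" by (simp add: admissible_def)
qed

end
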